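(* Let $m \geq 2$, $n \geq 1$ and $k \geq 0$ be integers. Then $$\vert\mathrm{Inc}_k(m\times n)\vert = \sum_{\ell=k}^{(m-1)(n-1)} \binom{\ell}{k} \, N(m,n,\ell).$$
   Context: For a partition $\lambda$ of $N$, an increasing $\lambda$-tableau is a filling of the Young diagram of $\lambda$ with positive integers such that rows (left to right) and columns (top to bottom) are strictly increasing and, if $N-k$ is the largest entry, every integer $i$ with $1\le i\le N-k$ appears at least once. $\mathrm{Inc}_k(\lambda)$ denotes the set of increasing $\lambda$-tableaux with maximum entry $N-k$, and $\mathrm{Inc}_k(m\times n)=\mathrm{Inc}_k(n^m)$ is the case of the rectangular shape with $m$ rows and $n$ columns ($N=mn$). Let $\mathcal{C}(m,n)$ be the set of lattice paths in $\mathbb{R}^m$ from $(0,\dots,0)$ to $(n,\dots,n)$ using unit steps $X_1=(1,0,\dots,0),\dots,X_m=(0,\dots,0,1)$ and staying in the region $\{(x_1,\dots,x_m): 0\le x_m\le x_{m-1}\le\cdots\le x_1\}$. For a path $P=\epsilon_1\cdots\epsilon_{mn}$, an ascent is an index $i$ with $\epsilon_{i-1}\epsilon_i=X_jX_r$ and $r<j$. For $m\ge 2$ and $0\le \ell\le (m-1)(n-1)$, the $m$-Narayana number $N(m,n,\ell)$ is the number of paths in $\mathcal{C}(m,n)$ with exactly $\ell$ ascents. *)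

theory Defs
  imports Main "HOL-Library.FuncSet"
begin

text \<open>A partition is given by the list of its parts in weakly decreasing order. Rows and columns
  of Young diagrams are numbered from 0.\<close>

definition young_diagram :: "nat list \<Rightarrow> (nat \<times> nat) set" where
  "young_diagram lam = {(i, j). i < length lam \<and> j < lam ! i}"

definition entries :: "nat list \<Rightarrow> (nat \<times> nat \<Rightarrow> nat) \<Rightarrow> nat set" where
  "entries lam T = T ` young_diagram lam"

text \<open>Entries of tableaux are positive, so inserting 0 affects the maximum only for the empty
  diagram.\<close>

definition max_entry :: "nat list \<Rightarrow> (nat \<times> nat \<Rightarrow> nat) \<Rightarrow> nat" where
  "max_entry lam T = Max (insert 0 (entries lam T))"

text \<open>Fillings are extensional functions on the diagram, so that distinct functions are distinct
  fillings.\<close>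

definition increasing_tableau :: "nat list \<Rightarrow> (nat \<times> nat \<Rightarrow> nat) \<Rightarrow> bool" where
  "increasing_tableau lam T \<longleftrightarrow>
     T \<in> young_diagram lam \<rightarrow>\<^sub>E {1..} \<and>
     (\<forall>i j j'. (i, j) \<in> young_diagram lam \<and> (i, j') \<in> young_diagram lam \<and> j < j'
        \<longrightarrow> T (i, j) < T (i, j')) \<and>
     (\<forall>i i' j. (i, j) \<in> young_diagram lam \<and> (i', j) \<in> young_diagram lam \<and> i < i'
        \<longrightarrow> T (i, j) < T (i', j)) \<and>
     (\<forall>v. 1 \<le> v \<and> v \<le> max_entry lam T \<longrightarrow> v \<in> entries lam T)"

text \<open>The condition that the maximum entry is \<open>N - k\<close>, where \<open>N = sum_list lam\<close>, is written
  additively to avoid truncated subtraction.\<close>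

definition Inc :: "nat \<Rightarrow> nat list \<Rightarrow> (nat \<times> nat \<Rightarrow> nat) set" where
  "Inc k lam = {T. increasing_tableau lam T \<and> max_entry lam T + k = sum_list lam}"

definition Inc_rect :: "nat \<Rightarrow> nat \<Rightarrow> nat \<Rightarrow> (nat \<times> nat \<Rightarrow> nat) set" where
  "Inc_rect k m n = Inc k (replicate m n)"

text \<open>Points of \<open>\<int>\<^sup>m\<close> are functions read at the coordinates \<open>1, \<dots>, m\<close>. A path is the list of the
  indices \<open>j\<close> of its steps \<open>X\<^sub>j\<close>.\<close>

definition unit_step :: "nat \<Rightarrow> nat \<Rightarrow> int" where
  "unit_step j = (\<lambda>r. if r = j then 1 else 0)"

definition path_end :: "nat list \<Rightarrow> nat \<Rightarrow> int" where
  "path_end P = (\<lambda>r. \<Sum>j\<leftarrow>P. unit_step j r)"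

definition in_region :: "nat \<Rightarrow> (nat \<Rightarrow> int) \<Rightarrow> bool" where
  "in_region m x \<longleftrightarrow> 0 \<le> x m \<and> (\<forall>j. 1 \<le> j \<and> j < m \<longrightarrow> x (Suc j) \<le> x j)"

text \<open>The region is convex, so a path stays in it iff all of its vertices, the ends of its initial
  segments, do.\<close>

definition lattice_paths :: "nat \<Rightarrow> nat \<Rightarrow> nat list set" where
  "lattice_paths m n = {P. set P \<subseteq> {1..m} \<and>
     (\<forall>r\<in>{1..m}. path_end P r = int n) \<and>
     (\<forall>i\<le>length P. in_region m (path_end (take i P)))}"

text \<open>List positions start at 0; the first step has no predecessor.\<close>

definition ascents :: "nat list \<Rightarrow> nat set" where
  "ascents P = {i. 0 < i \<and> i < length P \<and> P ! i < P ! (i - 1)}"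

definition narayana :: "nat \<Rightarrow> nat \<Rightarrow> nat \<Rightarrow> nat" where
  "narayana m n l = card {P \<in> lattice_paths m n. card (ascents P) = l}"

end

theory Submission
  imports Defs "HOL-Library.Sublist"
begin

text \<open>The rows containing a given entry \<open>v\<close> of an increasing tableau form a set, since entries do
  not repeat within a row. Writing these sets as decreasing words of row numbers and concatenating
  them for \<open>v = 1, 2, \<dots>\<close> gives a lattice path; decreasing order turns strictness of the columns
  into the condition that the path stays in the region. Conversely, a tableau is recovered from a
  path together with a way of cutting it into decreasing blocks, i.e. a choice of the ascents that
  are not cut, and leaving \<open>k\<close> of them uncut gives maximum entry \<open>m n - k\<close>. The same correspondence
  holds for every partition shape, with ballot words in place of lattice paths. The upper summation
  bound holds because the entry in the last corner of the rectangle is at least \<open>m + n - 1\<close>, even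
  if all ascents are left uncut.\<close>

section \<open>Decreasing factorizations of words\<close>

definition decreasing_blocks :: "'a::linorder list list \<Rightarrow> bool" where
  "decreasing_blocks Ls \<longleftrightarrow> (\<forall>L\<in>set Ls. L \<noteq> [] \<and> sorted_wrt (>) L)"

definition decreasing_factorizations :: "'a::linorder list \<Rightarrow> 'a list list set" where
  "decreasing_factorizations P = {Ls. decreasing_blocks Ls \<and> concat Ls = P}"

definition extend_first_block :: "'a \<Rightarrow> 'a list list \<Rightarrow> 'a list list" where
  "extend_first_block x Ls = (x # hd Ls) # tl Ls"

lemma decreasing_blocks_simps [simp]:
  "decreasing_blocks []"
  "decreasing_blocks (L # Ls) \<longleftrightarrow> L \<noteq> [] \<and> sorted_wrt (>) L \<and> decreasing_blocks Ls"
  "decreasing_blocks (Ls @ Ls') \<longleftrightarrow> decreasing_blocks Ls \<and> decreasing_blocks Ls'"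
  by (auto simp: decreasing_blocks_def)

lemma length_le_length_concat: "decreasing_blocks Ls \<Longrightarrow> length Ls \<le> length (concat Ls)"
proof (induction Ls)
  case (Cons L Ls)
  then show ?case by (cases L) auto
qed simp

lemma decreasing_factorizations_Nil [simp]: "decreasing_factorizations [] = {[]}"
proof -
  have "Ls = []" if "decreasing_blocks Ls" "concat Ls = []" for Ls :: "'a list list"
    using length_le_length_concat[OF that(1)] that(2) by simp
  then show ?thesis by (auto simp: decreasing_factorizations_def)
qed

lemma decreasing_factorizations_ConsE:
  assumes "Ls \<in> decreasing_factorizations (x # P)"
  obtains L Ls' where "Ls = (x # L) # Ls'" "L @ concat Ls' = P"
    "sorted_wrt (>) (x # L)" "decreasing_blocks Ls'"
proof -
  obtain L' Ls' where "Ls = L' # Ls'" "L' \<noteq> []"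
    using assms by (cases Ls) (auto simp: decreasing_factorizations_def)
  with assms that show thesis
    by (cases L') (auto simp: decreasing_factorizations_def)
qed

lemma decreasing_factorizations_Cons:
  "decreasing_factorizations (x # P) = (#) [x] ` decreasing_factorizations P \<union>
     (if P \<noteq> [] \<and> hd P < x then extend_first_block x ` decreasing_factorizations P else {})"
  (is "_ = ?cut \<union> ?uncut")
proof (intro equalityI subsetI)
  fix Ls assume "Ls \<in> decreasing_factorizations (x # P)"
  then obtain L Ls' where Ls: "Ls = (x # L) # Ls'" "L @ concat Ls' = P"
    "sorted_wrt (>) (x # L)" "decreasing_blocks Ls'"
    by (rule decreasing_factorizations_ConsE)
  show "Ls \<in> ?cut \<union> ?uncut"
  proof (cases "L = []")
    case True
    with Ls show ?thesis by (auto simp: decreasing_factorizations_def)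
  next
    case False
    with Ls have "L # Ls' \<in> decreasing_factorizations P" "P \<noteq> []" "hd P < x"
      by (auto simp: decreasing_factorizations_def hd_append)
    moreover have "Ls = extend_first_block x (L # Ls')"
      using Ls(1) by (simp add: extend_first_block_def)
    ultimately show ?thesis by auto
  qed
next
  fix Ls assume "Ls \<in> ?cut \<union> ?uncut"
  then consider (cut) "Ls \<in> ?cut" | (uncut) y P' Ls' where "P = y # P'" "y < x"
      "Ls' \<in> decreasing_factorizations (y # P')" "Ls = extend_first_block x Ls'"
    by (cases P) (auto split: if_splits)
  then show "Ls \<in> decreasing_factorizations (x # P)"
  proof cases
    case cut
    then show ?thesis by (auto simp: decreasing_factorizations_def)
  next
    case uncut
    from uncut(3) obtain L Ms where "Ls' = (y # L) # Ms" "L @ concat Ms = P'"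
      "sorted_wrt (>) (y # L)" "decreasing_blocks Ms"
      by (rule decreasing_factorizations_ConsE)
    with uncut show ?thesis
      by (auto simp: decreasing_factorizations_def extend_first_block_def)
  qed
qed

lemma decreasing_factorizations_nonempty:
  assumes "Ls \<in> decreasing_factorizations P" "P \<noteq> []"
  shows "Ls \<noteq> []" "hd Ls \<noteq> []"
  using assms by (cases P; auto elim: decreasing_factorizations_ConsE)+

lemma finite_decreasing_factorizations [simp]: "finite (decreasing_factorizations P)"
  by (induction P) (simp_all add: decreasing_factorizations_Cons)

lemma inj_on_extend_first_block: "inj_on (extend_first_block x) {Ls. Ls \<noteq> []}"
  by (rule inj_onI) (auto simp: extend_first_block_def neq_Nil_conv)

text \<open>The parameter \<open>k\<close> is the number of ascents that are not cut: each of them saves one block.\<close>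

definition factorizations_with_uncut :: "nat \<Rightarrow> 'a::linorder list \<Rightarrow> 'a list list set" where
  "factorizations_with_uncut k P = {Ls \<in> decreasing_factorizations P. length Ls + k = length P}"

lemma factorizations_with_uncut_Cons:
  "factorizations_with_uncut k (x # P) = (#) [x] ` factorizations_with_uncut k P \<union>
     (if P \<noteq> [] \<and> hd P < x \<and> k \<noteq> 0
      then extend_first_block x ` factorizations_with_uncut (k - 1) P else {})"
proof -
  let ?F = "decreasing_factorizations P"
  have cut: "{Ls \<in> (#) [x] ` ?F. length Ls + k = length (x # P)} =
      (#) [x] ` factorizations_with_uncut k P"
    by (auto simp: factorizations_with_uncut_def)
  have uncut: "{Ls \<in> extend_first_block x ` ?F. length Ls + k = length (x # P)} =
      (if k \<noteq> 0 then extend_first_block x ` factorizations_with_uncut (k - 1) P else {})"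
    if "P \<noteq> []"
  proof -
    have "length (extend_first_block x Ls) + k = length (x # P) \<longleftrightarrow>
        k \<noteq> 0 \<and> length Ls + (k - 1) = length P" if "Ls \<in> ?F" for Ls
    proof -
      have "Ls \<noteq> []" using that \<open>P \<noteq> []\<close> by (rule decreasing_factorizations_nonempty)
      moreover have "length Ls \<le> length P"
        using that length_le_length_concat by (auto simp: decreasing_factorizations_def)
      ultimately show ?thesis by (cases k) (auto simp: extend_first_block_def)
    qed
    then show ?thesis by (auto simp: factorizations_with_uncut_def)
  qed
  have "factorizations_with_uncut k (x # P) =
      {Ls \<in> (#) [x] ` ?F. length Ls + k = length (x # P)} \<union>
      (if P \<noteq> [] \<and> hd P < x
       then {Ls \<in> extend_first_block x ` ?F. length Ls + k = length (x # P)} else {})"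
    unfolding factorizations_with_uncut_def decreasing_factorizations_Cons by auto
  then show ?thesis
    by (cases "P \<noteq> [] \<and> hd P < x")
       (simp_all only: cut uncut conj_assoc[symmetric] simp_thms if_True if_False Un_empty_right)
qed

lemma ascents_Cons:
  "ascents (x # P) = Suc ` ascents P \<union> (if P \<noteq> [] \<and> hd P < x then {1} else {})"
proof (intro set_eqI)
  fix i
  show "i \<in> ascents (x # P) \<longleftrightarrow>
      i \<in> Suc ` ascents P \<union> (if P \<noteq> [] \<and> hd P < x then {1} else {})"
  proof (cases i)
    case (Suc i')
    then show ?thesis by (cases i') (auto simp: ascents_def image_iff hd_conv_nth)
  qed (auto simp: ascents_def)
qed

lemma finite_ascents [simp]: "finite (ascents P)"
  by (rule finite_subset[of _ "{..<length P}"]) (auto simp: ascents_def)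

lemma card_ascents_Cons:
  "card (ascents (x # P)) = card (ascents P) + (if P \<noteq> [] \<and> hd P < x then 1 else 0)"
proof -
  have "1 \<notin> Suc ` ascents P" by (auto simp: ascents_def)
  then show ?thesis by (simp add: ascents_Cons card_image)
qed

lemma card_factorizations_with_uncut:
  "card (factorizations_with_uncut k P) = card (ascents P) choose k"
proof (induction P arbitrary: k)
  case Nil
  have "factorizations_with_uncut k [] = (if k = 0 then {[] :: nat list list} else {})"
    by (auto simp: factorizations_with_uncut_def)
  then show ?case by (simp add: ascents_def)
next
  case (Cons x P)
  have card_cut: "card ((#) [x] ` factorizations_with_uncut k P) = card (ascents P) choose k"
    using Cons.IH by (simp add: card_image)
  show ?case
  proof (cases "P \<noteq> [] \<and> hd P < x \<and> k \<noteq> 0")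
    case False
    with card_cut show ?thesis
      by (auto simp: factorizations_with_uncut_Cons card_ascents_Cons)
  next
    case True
    then obtain k' where k: "k = Suc k'" by (cases k) auto
    have nonempty: "Ls \<noteq> [] \<and> hd Ls \<noteq> []" if "Ls \<in> factorizations_with_uncut k' P" for Ls
      using that True decreasing_factorizations_nonempty
      by (auto simp: factorizations_with_uncut_def)
    then have "inj_on (extend_first_block x) (factorizations_with_uncut k' P)"
      by (intro inj_on_subset[OF inj_on_extend_first_block]) auto
    then have "card (extend_first_block x ` factorizations_with_uncut k' P) =
        card (ascents P) choose k'"
      using Cons.IH by (simp add: card_image)
    moreover have "(#) [x] ` factorizations_with_uncut k P \<inter>
        extend_first_block x ` factorizations_with_uncut k' P = {}"
      using nonempty by (fastforce simp: extend_first_block_def)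
    moreover have "finite (factorizations_with_uncut j P)" for j
      by (simp add: factorizations_with_uncut_def)
    ultimately show ?thesis
      using True card_cut
      by (simp add: k factorizations_with_uncut_Cons card_Un_disjoint card_ascents_Cons)
  qed
qed

section \<open>Ballot words\<close>

definition content :: "nat \<Rightarrow> nat list \<Rightarrow> nat list" where
  "content m P = map (count_list P) [1..<Suc m]"

definition ballot_words :: "nat list \<Rightarrow> nat list set" where
  "ballot_words lam = {P. set P \<subseteq> {1..length lam} \<and> content (length lam) P = lam \<and>
     (\<forall>u. prefix u P \<longrightarrow> sorted (rev (content (length lam) u)))}"

definition dominates_in_prefixes :: "'a \<Rightarrow> 'a \<Rightarrow> 'a list \<Rightarrow> bool" where
  "dominates_in_prefixes a b w \<longleftrightarrow> (\<forall>u. prefix u w \<longrightarrow> count_list u b \<le> count_list u a)"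

lemma length_content [simp]: "length (content m P) = m"
  by (simp add: content_def)

lemma nth_content [simp]: "i < m \<Longrightarrow> content m P ! i = count_list P (Suc i)"
  by (simp add: content_def del: upt_Suc)

lemma all_prefix_iff_all_take: "(\<forall>u. prefix u P \<longrightarrow> Q u) \<longleftrightarrow> (\<forall>i\<le>length P. Q (take i P))"
  by (auto simp: take_is_prefix) (metis append_eq_conv_conj prefix_def prefix_length_le)

lemma path_end_eq_count_list: "path_end P r = int (count_list P r)"
  by (induction P) (auto simp: path_end_def unit_step_def)

lemma in_region_path_end_iff: "in_region m (path_end P) \<longleftrightarrow> sorted (rev (content m P))"
proof -
  have "in_region m (path_end P) \<longleftrightarrow>
      (\<forall>j. 1 \<le> j \<and> j < m \<longrightarrow> count_list P (Suc j) \<le> count_list P j)"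
    by (simp add: in_region_def path_end_eq_count_list)
  also have "\<dots> \<longleftrightarrow> (\<forall>i. Suc i < m \<longrightarrow> count_list P (Suc (Suc i)) \<le> count_list P (Suc i))"
    by (metis One_nat_def Suc_le_D le_add1 plus_1_eq_Suc)
  also have "\<dots> \<longleftrightarrow> sorted (rev (content m P))"
    by (simp add: sorted_rev_iff_nth_Suc)
  finally show ?thesis .
qed

lemma lattice_paths_eq_ballot_words: "lattice_paths m n = ballot_words (replicate m n)"
proof -
  have "(\<forall>r\<in>{1..m}. path_end P r = int n) \<longleftrightarrow> content m P = replicate m n" for P
  proof -
    have "(\<forall>r\<in>{1..m}. path_end P r = int n) \<longleftrightarrow> (\<forall>r\<in>Suc ` {..<m}. count_list P r = n)"
      by (simp only: image_Suc_lessThan path_end_eq_count_list of_nat_eq_iff)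
    also have "\<dots> \<longleftrightarrow> content m P = replicate m n"
      by (auto simp: list_eq_iff_nth_eq)
    finally show ?thesis .
  qed
  then show ?thesis
    unfolding lattice_paths_def ballot_words_def in_region_path_end_iff length_replicate
      all_prefix_iff_all_take by simp
qed

lemma length_ballot_word:
  assumes "P \<in> ballot_words lam"
  shows "length P = sum_list lam"
proof -
  let ?m = "length lam"
  have P: "set P \<subseteq> {1..?m}" "content ?m P = lam" using assms by (auto simp: ballot_words_def)
  have "length P = (\<Sum>r\<in>set P. count_list P r)" by (simp add: sum_count_set)
  also have "\<dots> = (\<Sum>r\<in>set [1..<Suc ?m]. count_list P r)"
    using P(1) by (intro sum.mono_neutral_left) (auto simp: count_list_0_iff)
  also have "\<dots> = sum_list (content ?m P)"
    unfolding content_def by (simp only: interv_sum_list_conv_sum_set_nat)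
  finally show ?thesis using P(2) by simp
qed

lemma finite_ballot_words: "finite (ballot_words lam)"
  by (rule finite_subset[OF _ finite_lists_length_eq[of "{1..length lam}" "sum_list lam"]])
     (auto simp: length_ballot_word, auto simp: ballot_words_def)

lemma ballot_words_iff:
  "P \<in> ballot_words lam \<longleftrightarrow> set P \<subseteq> {1..length lam} \<and>
     (\<forall>i<length lam. count_list P (Suc i) = lam ! i) \<and>
     (\<forall>i' < length lam. \<forall>i<i'. dominates_in_prefixes (Suc i) (Suc i') P)"
proof -
  have "content (length lam) P = lam \<longleftrightarrow> (\<forall>i<length lam. count_list P (Suc i) = lam ! i)"
    by (simp add: list_eq_iff_nth_eq)
  moreover have "sorted (rev (content (length lam) u)) \<longleftrightarrow>
      (\<forall>i' < length lam. \<forall>i<i'. count_list u (Suc i') \<le> count_list u (Suc i))" for u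
    unfolding sorted_wrt_rev by (auto simp: sorted_wrt_iff_nth_less)
  then have "(\<forall>u. prefix u P \<longrightarrow> sorted (rev (content (length lam) u))) \<longleftrightarrow>
      (\<forall>i' < length lam. \<forall>i<i'. dominates_in_prefixes (Suc i) (Suc i') P)"
    unfolding dominates_in_prefixes_def by (simp only:) blast
  ultimately show ?thesis by (simp add: ballot_words_def)
qed

section \<open>Ballot words cut into decreasing blocks\<close>

definition count_in_first_blocks :: "'a list list \<Rightarrow> 'a \<Rightarrow> nat \<Rightarrow> nat" where
  "count_in_first_blocks Ls r v = count_list (concat (take v Ls)) r"

definition ballot_blocks :: "nat list \<Rightarrow> nat list list set" where
  "ballot_blocks lam = {Ls. decreasing_blocks Ls \<and> concat Ls \<in> ballot_words lam}"

lemma count_list_decreasing: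
  "sorted_wrt (>) L \<Longrightarrow> count_list L (r :: 'a::linorder) = (if r \<in> set L then 1 else 0)"
  by (induction L) auto

text \<open>Within a decreasing block \<open>b\<close> comes before the smaller letter \<open>a\<close>, so that \<open>a\<close> cannot
  compensate for it.\<close>

lemma dominates_in_prefixes_append_decreasing:
  fixes a b :: "'a::linorder"
  assumes "sorted_wrt (>) L" and "a < b"
  shows "dominates_in_prefixes a b (w @ L) \<longleftrightarrow>
    dominates_in_prefixes a b w \<and> count_list (w @ L) b \<le> count_list w a"
proof (intro iffI conjI)
  assume dom: "dominates_in_prefixes a b (w @ L)"
  then show dom_w: "dominates_in_prefixes a b w" by (simp add: dominates_in_prefixes_def)
  show "count_list (w @ L) b \<le> count_list w a"
  proof (cases "b \<in> set L")
    case True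
    then obtain xs ys where L: "L = xs @ b # ys" by (auto simp: in_set_conv_decomp)
    with assms have "count_list xs a = 0" "count_list ys b = 0"
      by (auto simp: sorted_wrt_append count_list_0_iff)
    moreover have "prefix (w @ xs @ [b]) (w @ L)" by (simp add: L)
    with dom have "count_list (w @ xs @ [b]) b \<le> count_list (w @ xs @ [b]) a"
      unfolding dominates_in_prefixes_def by blast
    ultimately show ?thesis using \<open>a < b\<close> by (simp add: L split: if_splits)
  next
    case False
    with dom_w show ?thesis by (simp add: dominates_in_prefixes_def count_list_0_iff)
  qed
next
  assume dom: "dominates_in_prefixes a b w \<and> count_list (w @ L) b \<le> count_list w a"
  show "dominates_in_prefixes a b (w @ L)"
    unfolding dominates_in_prefixes_def prefix_append
  proof (intro allI impI, elim disjE exE conjE)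
    fix u us assume "u = w @ us" "prefix us L"
    then show "count_list u b \<le> count_list u a" using dom by (auto elim!: prefixE)
  qed (use dom in \<open>simp add: dominates_in_prefixes_def\<close>)
qed

lemma dominates_in_prefixes_concat_iff:
  fixes a b :: "'a::linorder"
  assumes "decreasing_blocks Ls" and "a < b"
  shows "dominates_in_prefixes a b (concat Ls) \<longleftrightarrow>
    (\<forall>v<length Ls. count_in_first_blocks Ls b (Suc v) \<le> count_in_first_blocks Ls a v)"
  using assms(1)
proof (induction Ls rule: rev_induct)
  case Nil
  show ?case by (simp add: dominates_in_prefixes_def)
next
  case (snoc L Ls)
  then have "dominates_in_prefixes a b (concat (Ls @ [L])) \<longleftrightarrow>
      (\<forall>v<length Ls. count_in_first_blocks Ls b (Suc v) \<le> count_in_first_blocks Ls a v) \<and>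
      count_list (concat Ls @ L) b \<le> count_list (concat Ls) a"
    using \<open>a < b\<close> by (simp add: dominates_in_prefixes_append_decreasing)
  then show ?case by (auto simp: count_in_first_blocks_def less_Suc_eq)
qed

lemma count_in_first_blocks_0 [simp]: "count_in_first_blocks Ls r 0 = 0"
  by (simp add: count_in_first_blocks_def)

lemma count_in_first_blocks_Suc:
  assumes "decreasing_blocks Ls"
  shows "count_in_first_blocks Ls r (Suc v) =
    count_in_first_blocks Ls r v + (if v < length Ls \<and> r \<in> set (Ls ! v) then 1 else 0)"
proof (cases "v < length Ls")
  case True
  then have "sorted_wrt (>) (Ls ! v)" using assms by (simp add: decreasing_blocks_def)
  with True show ?thesis
    by (simp add: count_in_first_blocks_def take_Suc_conv_app_nth count_list_decreasing)
qed (simp add: count_in_first_blocks_def)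

lemma mono_count_in_first_blocks:
  "decreasing_blocks Ls \<Longrightarrow> mono (count_in_first_blocks Ls r)"
  by (simp add: mono_iff_le_Suc count_in_first_blocks_Suc)

lemma decreasing_blocks_if_ballot_blocks: "Ls \<in> ballot_blocks lam \<Longrightarrow> decreasing_blocks Ls"
  by (simp add: ballot_blocks_def)

lemma count_in_first_blocks_eq_part:
  assumes "Ls \<in> ballot_blocks lam" "i < length lam" "length Ls \<le> v"
  shows "count_in_first_blocks Ls (Suc i) v = lam ! i"
  using assms by (simp add: ballot_blocks_def ballot_words_iff count_in_first_blocks_def)

lemma count_in_first_blocks_le_part:
  assumes "Ls \<in> ballot_blocks lam" "i < length lam"
  shows "count_in_first_blocks Ls (Suc i) v \<le> lam ! i"
proof -
  have "count_in_first_blocks Ls (Suc i) v \<le> count_in_first_blocks Ls (Suc i) (max v (length Ls))"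
    using assms
    by (intro monoD[OF mono_count_in_first_blocks] decreasing_blocks_if_ballot_blocks) auto
  with assms show ?thesis by (simp add: count_in_first_blocks_eq_part)
qed

lemma ballot_blocks_iff:
  "Ls \<in> ballot_blocks lam \<longleftrightarrow> decreasing_blocks Ls \<and> set (concat Ls) \<subseteq> {1..length lam} \<and>
     (\<forall>i<length lam. count_in_first_blocks Ls (Suc i) (length Ls) = lam ! i) \<and>
     (\<forall>i' < length lam. \<forall>i<i'. \<forall>v<length Ls.
       count_in_first_blocks Ls (Suc i') (Suc v) \<le> count_in_first_blocks Ls (Suc i) v)"
proof -
  have "count_list (concat Ls) r = count_in_first_blocks Ls r (length Ls)" for r
    by (simp add: count_in_first_blocks_def)
  then show ?thesis
    by (auto simp: ballot_blocks_def ballot_words_iff dominates_in_prefixes_concat_iff)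
qed

lemma card_ballot_blocks:
  "card {Ls \<in> ballot_blocks lam. length Ls + k = sum_list lam} =
    (\<Sum>P\<in>ballot_words lam. card (ascents P) choose k)"
proof -
  have "{Ls \<in> ballot_blocks lam. length Ls + k = sum_list lam} =
      (\<Union>P\<in>ballot_words lam. factorizations_with_uncut k P)"
    by (auto simp: ballot_blocks_def factorizations_with_uncut_def decreasing_factorizations_def
        length_ballot_word)
  also have "card \<dots> = (\<Sum>P\<in>ballot_words lam. card (factorizations_with_uncut k P))"
    by (intro card_UN_disjoint finite_ballot_words ballI impI)
       (simp add: factorizations_with_uncut_def,
        auto simp: factorizations_with_uncut_def decreasing_factorizations_def)
  finally show ?thesis by (simp add: card_factorizations_with_uncut)
qed

section \<open>Increasing tableaux\<close>

lemma mem_young_diagram_iff [simp]: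
  "(i, j) \<in> young_diagram lam \<longleftrightarrow> i < length lam \<and> j < lam ! i"
  by (simp add: young_diagram_def)

lemma finite_young_diagram [simp]: "finite (young_diagram lam)"
proof -
  have "young_diagram lam = (SIGMA i:{..<length lam}. {..<lam ! i})" by auto
  then show ?thesis by simp
qed

lemma max_entry_eqI: "entries lam T = {1..M} \<Longrightarrow> max_entry lam T = M"
  unfolding max_entry_def by (intro Max_eqI) auto

lemma entry_le_max_entry: "(i, j) \<in> young_diagram lam \<Longrightarrow> T (i, j) \<le> max_entry lam T"
  unfolding max_entry_def entries_def by (intro Max_ge) auto

lemma increasing_tableau_pos:
  assumes "increasing_tableau lam T" "(i, j) \<in> young_diagram lam"
  shows "0 < T (i, j)"
proof -
  have "T \<in> young_diagram lam \<rightarrow>\<^sub>E {1..}" using assms(1) by (simp add: increasing_tableau_def)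
  then have "T (i, j) \<in> {1..}" using assms(2) by (rule PiE_mem)
  then show ?thesis by simp
qed

lemma increasing_tableau_row_less:
  "increasing_tableau lam T \<Longrightarrow> (i, j') \<in> young_diagram lam \<Longrightarrow> j < j' \<Longrightarrow> T (i, j) < T (i, j')"
  by (auto simp: increasing_tableau_def)

lemma increasing_tableau_column_less:
  assumes "increasing_tableau lam T" "sorted (rev lam)" "(i', j) \<in> young_diagram lam" "i < i'"
  shows "T (i, j) < T (i', j)"
  using assms sorted_rev_nth_mono[of lam i i'] by (auto simp: increasing_tableau_def)

lemma increasing_tableau_gt_index_sum:
  assumes incr: "increasing_tableau lam T" and part: "sorted (rev lam)"
  shows "(i, j) \<in> young_diagram lam \<Longrightarrow> i + j < T (i, j)"
proof (induction i arbitrary: j)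
  case 0
  then show ?case
  proof (induction j)
    case 0
    then show ?case using increasing_tableau_pos[OF incr] by simp
  next
    case (Suc j)
    then show ?case using increasing_tableau_row_less[OF incr, of 0 "Suc j" j] by simp
  qed
next
  case (Suc i)
  then have "(i, j) \<in> young_diagram lam" using sorted_rev_nth_mono[OF part, of i "Suc i"] by simp
  then have "i + j < T (i, j)" by (rule Suc.IH)
  moreover have "T (i, j) < T (Suc i, j)"
    using increasing_tableau_column_less[OF incr part Suc.prems] by simp
  ultimately show ?case by simp
qed

definition rows_with_entry :: "nat list \<Rightarrow> (nat \<times> nat \<Rightarrow> nat) \<Rightarrow> nat \<Rightarrow> nat set" where
  "rows_with_entry lam T v = {i. \<exists>j. (i, j) \<in> young_diagram lam \<and> T (i, j) = v}"

definition row_cells_le :: "nat list \<Rightarrow> (nat \<times> nat \<Rightarrow> nat) \<Rightarrow> nat \<Rightarrow> nat \<Rightarrow> nat set" where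
  "row_cells_le lam T i v = {j. (i, j) \<in> young_diagram lam \<and> T (i, j) \<le> v}"

lemma rows_with_entry_subset: "rows_with_entry lam T v \<subseteq> {..<length lam}"
  by (auto simp: rows_with_entry_def)

lemma finite_rows_with_entry [simp]: "finite (rows_with_entry lam T v)"
  by (rule finite_subset[OF rows_with_entry_subset]) simp

lemma rows_with_entry_eq_empty_iff: "rows_with_entry lam T v = {} \<longleftrightarrow> v \<notin> entries lam T"
  by (force simp: rows_with_entry_def entries_def)

lemma finite_row_cells_le [simp]: "finite (row_cells_le lam T i v)"
  by (rule finite_subset[of _ "{..<lam ! i}"]) (auto simp: row_cells_le_def)

lemma down_closed_eq_lessThan_card:
  fixes A :: "nat set"
  assumes "finite A" and "\<And>x y. x \<in> A \<Longrightarrow> y \<le> x \<Longrightarrow> y \<in> A"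
  shows "A = {..<card A}"
proof (cases "A = {}")
  case False
  with assms(1) have "Max A \<in> A" by simp
  then have "A = {..Max A}" using assms(1) by (auto intro: assms(2))
  then have "card A = Suc (Max A)" by (metis card_atMost)
  with \<open>A = {..Max A}\<close> show ?thesis by (simp add: lessThan_Suc_atMost)
qed simp

lemma mem_row_cells_le_iff:
  assumes "increasing_tableau lam T"
  shows "j \<in> row_cells_le lam T i v \<longleftrightarrow> j < card (row_cells_le lam T i v)"
proof -
  have "j \<in> row_cells_le lam T i v" if "j' \<in> row_cells_le lam T i v" "j \<le> j'" for j j'
    using that increasing_tableau_row_less[OF assms, of i j' j]
    by (cases "j = j'") (auto simp: row_cells_le_def)
  then have "row_cells_le lam T i v = {..<card (row_cells_le lam T i v)}"
    by (intro down_closed_eq_lessThan_card) auto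
  then show ?thesis by blast
qed

lemma card_row_cells_le_Suc:
  assumes incr: "increasing_tableau lam T"
  shows "card (row_cells_le lam T i (Suc v)) =
    card (row_cells_le lam T i v) + (if i \<in> rows_with_entry lam T (Suc v) then 1 else 0)"
proof (cases "i \<in> rows_with_entry lam T (Suc v)")
  case True
  then obtain j where j: "(i, j) \<in> young_diagram lam" "T (i, j) = Suc v"
    by (auto simp: rows_with_entry_def)
  have "j' = j" if "(i, j') \<in> young_diagram lam" "T (i, j') = Suc v" for j'
    using increasing_tableau_row_less[OF incr, of i j' j]
      increasing_tableau_row_less[OF incr, of i j j'] that j by (cases j j' rule: linorder_cases) auto
  with j have "row_cells_le lam T i (Suc v) = insert j (row_cells_le lam T i v)"
    by (auto simp: row_cells_le_def le_Suc_eq)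
  moreover have "j \<notin> row_cells_le lam T i v" using j by (simp add: row_cells_le_def)
  ultimately show ?thesis using True by simp
next
  case False
  then have "row_cells_le lam T i (Suc v) = row_cells_le lam T i v"
    by (auto simp: row_cells_le_def rows_with_entry_def le_Suc_eq)
  with False show ?thesis by simp
qed

section \<open>The correspondence between tableaux and ballot words\<close>

definition tableau_blocks :: "nat list \<Rightarrow> (nat \<times> nat \<Rightarrow> nat) \<Rightarrow> nat list list" where
  "tableau_blocks lam T =
     map (\<lambda>v. rev (sorted_list_of_set (Suc ` rows_with_entry lam T (Suc v)))) [0..<max_entry lam T]"

lemma length_tableau_blocks [simp]: "length (tableau_blocks lam T) = max_entry lam T"
  by (simp add: tableau_blocks_def)

lemma set_nth_tableau_blocks:
  "v < max_entry lam T \<Longrightarrow> set (tableau_blocks lam T ! v) = Suc ` rows_with_entry lam T (Suc v)"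
  by (simp add: tableau_blocks_def)

lemma decreasing_tableau_blocks:
  assumes "increasing_tableau lam T"
  shows "decreasing_blocks (tableau_blocks lam T)"
proof -
  have "rows_with_entry lam T (Suc v) \<noteq> {}" if "v < max_entry lam T" for v
    using assms that by (simp add: rows_with_entry_eq_empty_iff increasing_tableau_def)
  then show ?thesis by (auto simp: decreasing_blocks_def tableau_blocks_def sorted_wrt_rev)
qed

lemma count_in_first_tableau_blocks:
  assumes incr: "increasing_tableau lam T"
  shows "count_in_first_blocks (tableau_blocks lam T) (Suc i) v = card (row_cells_le lam T i v)"
proof (induction v)
  case 0
  have "row_cells_le lam T i 0 = {}"
    using increasing_tableau_pos[OF incr] by (fastforce simp: row_cells_le_def)
  then show ?case by simp
next
  case (Suc v)
  have "v < max_entry lam T \<and> Suc i \<in> set (tableau_blocks lam T ! v) \<longleftrightarrow>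
      i \<in> rows_with_entry lam T (Suc v)"
  proof (cases "v < max_entry lam T")
    case True
    then show ?thesis by (auto simp: set_nth_tableau_blocks)
  next
    case False
    then show ?thesis
      using entry_le_max_entry[of i _ lam T] by (fastforce simp: rows_with_entry_def)
  qed
  with Suc incr show ?case
    by (simp add: count_in_first_blocks_Suc decreasing_tableau_blocks card_row_cells_le_Suc)
qed

lemma tableau_blocks_in_ballot_blocks:
  assumes incr: "increasing_tableau lam T" and part: "sorted (rev lam)"
  shows "tableau_blocks lam T \<in> ballot_blocks lam"
  unfolding ballot_blocks_iff count_in_first_tableau_blocks[OF incr]
proof (intro conjI allI impI)
  show "decreasing_blocks (tableau_blocks lam T)" by (rule decreasing_tableau_blocks[OF incr])
  show "set (concat (tableau_blocks lam T)) \<subseteq> {1..length lam}"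
    using rows_with_entry_subset by (force simp: tableau_blocks_def)
next
  fix i assume "i < length lam"
  then have "row_cells_le lam T i (max_entry lam T) = {..<lam ! i}"
    using entry_le_max_entry[of i _ lam T] by (auto simp: row_cells_le_def)
  then show "card (row_cells_le lam T i (length (tableau_blocks lam T))) = lam ! i" by simp
next
  fix i' i v assume "i' < length lam" "i < i'"
  then have "row_cells_le lam T i' (Suc v) \<subseteq> row_cells_le lam T i v"
    using increasing_tableau_column_less[OF incr part, of i' _ i]
      sorted_rev_nth_mono[OF part, of i i']
    by (fastforce simp: row_cells_le_def)
  then show "card (row_cells_le lam T i' (Suc v)) \<le> card (row_cells_le lam T i v)"
    by (intro card_mono) simp_all
qed

text \<open>The entries up to \<open>v\<close> fill the leftmost cells of row \<open>i\<close>, as many as there are letters \<open>i + 1\<close>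
  in the first \<open>v\<close> blocks.\<close>

definition blocks_tableau :: "nat list \<Rightarrow> nat list list \<Rightarrow> nat \<times> nat \<Rightarrow> nat" where
  "blocks_tableau lam Ls =
     (\<lambda>(i, j)\<in>young_diagram lam. LEAST v. j < count_in_first_blocks Ls (Suc i) v)"

lemma blocks_tableau_le_iff:
  assumes Ls: "Ls \<in> ballot_blocks lam" and ij: "(i, j) \<in> young_diagram lam"
  shows "blocks_tableau lam Ls (i, j) \<le> v \<longleftrightarrow> j < count_in_first_blocks Ls (Suc i) v"
proof -
  let ?count = "count_in_first_blocks Ls (Suc i)"
  have eq_Least: "blocks_tableau lam Ls (i, j) = (LEAST v. j < ?count v)"
    using ij by (simp add: blocks_tableau_def)
  have "j < ?count (length Ls)" using ij by (simp add: count_in_first_blocks_eq_part[OF Ls])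
  then have attained: "j < ?count (blocks_tableau lam Ls (i, j))"
    unfolding eq_Least by (rule LeastI)
  have "mono ?count"
    by (intro mono_count_in_first_blocks decreasing_blocks_if_ballot_blocks[OF Ls])
  show ?thesis
  proof
    assume "blocks_tableau lam Ls (i, j) \<le> v"
    with \<open>mono ?count\<close> have "?count (blocks_tableau lam Ls (i, j)) \<le> ?count v" by (rule monoD)
    with attained show "j < ?count v" by (rule less_le_trans)
  next
    assume "j < ?count v"
    then show "blocks_tableau lam Ls (i, j) \<le> v" unfolding eq_Least by (rule Least_le)
  qed
qed

lemma blocks_tableau_pos:
  "Ls \<in> ballot_blocks lam \<Longrightarrow> (i, j) \<in> young_diagram lam \<Longrightarrow> 0 < blocks_tableau lam Ls (i, j)"
  using blocks_tableau_le_iff[of Ls lam i j 0] by simp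

lemma blocks_tableau_le_length:
  "Ls \<in> ballot_blocks lam \<Longrightarrow> (i, j) \<in> young_diagram lam \<Longrightarrow> blocks_tableau lam Ls (i, j) \<le> length Ls"
  by (simp add: blocks_tableau_le_iff count_in_first_blocks_eq_part)

lemma rows_with_entry_blocks_tableau:
  assumes Ls: "Ls \<in> ballot_blocks lam" and v: "v < length Ls"
  shows "Suc ` rows_with_entry lam (blocks_tableau lam Ls) (Suc v) = set (Ls ! v)"
proof -
  let ?T = "blocks_tableau lam Ls" and ?count = "\<lambda>i. count_in_first_blocks Ls (Suc i)"
  have dec: "decreasing_blocks Ls" by (rule decreasing_blocks_if_ballot_blocks[OF Ls])
  have "i \<in> rows_with_entry lam ?T (Suc v) \<longleftrightarrow> Suc i \<in> set (Ls ! v)" if i: "i < length lam" for i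
  proof -
    have "i \<in> rows_with_entry lam ?T (Suc v) \<longleftrightarrow>
        (\<exists>j<lam ! i. ?T (i, j) \<le> Suc v \<and> \<not> ?T (i, j) \<le> v)"
      using i by (auto simp: rows_with_entry_def le_Suc_eq)
    also have "\<dots> \<longleftrightarrow> (\<exists>j<lam ! i. j < ?count i (Suc v) \<and> \<not> j < ?count i v)"
      using i by (auto simp: blocks_tableau_le_iff[OF Ls])
    also have "\<dots> \<longleftrightarrow> ?count i v < ?count i (Suc v)"
      using count_in_first_blocks_le_part[OF Ls i, of "Suc v"]
      by (auto intro!: exI[of _ "?count i v"])
    also have "\<dots> \<longleftrightarrow> Suc i \<in> set (Ls ! v)"
      using v by (simp add: count_in_first_blocks_Suc[OF dec])
    finally show ?thesis .
  qed
  moreover have "set (Ls ! v) \<subseteq> Suc ` {..<length lam}"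
    using Ls nth_mem[OF v] by (auto simp: ballot_blocks_iff image_Suc_lessThan)
  ultimately show ?thesis
    using rows_with_entry_subset[of lam ?T "Suc v"] by (auto 0 3)
qed

lemma entries_blocks_tableau:
  assumes Ls: "Ls \<in> ballot_blocks lam"
  shows "entries lam (blocks_tableau lam Ls) = {1..length Ls}"
proof (intro equalityI subsetI)
  fix v assume "v \<in> entries lam (blocks_tableau lam Ls)"
  then obtain i j where "(i, j) \<in> young_diagram lam" "v = blocks_tableau lam Ls (i, j)"
    by (auto simp: entries_def)
  then show "v \<in> {1..length Ls}"
    using blocks_tableau_pos[OF Ls] blocks_tableau_le_length[OF Ls] by (simp add: Suc_le_eq)
next
  fix v assume "v \<in> {1..length Ls}"
  then obtain v' where v': "v = Suc v'" "v' < length Ls" by (cases v) auto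
  then have "set (Ls ! v') \<noteq> {}"
    using decreasing_blocks_if_ballot_blocks[OF Ls] by (simp add: decreasing_blocks_def)
  then show "v \<in> entries lam (blocks_tableau lam Ls)"
    using rows_with_entry_blocks_tableau[OF Ls v'(2)] v'(1)
      rows_with_entry_eq_empty_iff[of lam "blocks_tableau lam Ls" v] by auto
qed

lemma max_entry_blocks_tableau:
  "Ls \<in> ballot_blocks lam \<Longrightarrow> max_entry lam (blocks_tableau lam Ls) = length Ls"
  by (intro max_entry_eqI entries_blocks_tableau)

lemma increasing_blocks_tableau:
  assumes Ls: "Ls \<in> ballot_blocks lam"
  shows "increasing_tableau lam (blocks_tableau lam Ls)"
proof -
  let ?T = "blocks_tableau lam Ls" and ?count = "\<lambda>i. count_in_first_blocks Ls (Suc i)"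
  have dec: "decreasing_blocks Ls" by (rule decreasing_blocks_if_ballot_blocks[OF Ls])
  have entry_Suc: "\<exists>v<length Ls. ?T (i, j) = Suc v \<and> j < ?count i (Suc v)"
    if "(i, j) \<in> young_diagram lam" for i j
    using blocks_tableau_pos[OF Ls that] blocks_tableau_le_length[OF Ls that]
      blocks_tableau_le_iff[OF Ls that, of "?T (i, j)"] by (cases "?T (i, j)") auto
  have row: "?T (i, j) < ?T (i, j')"
    if cells: "(i, j) \<in> young_diagram lam" "(i, j') \<in> young_diagram lam" and "j < j'" for i j j'
  proof -
    obtain v where v: "?T (i, j') = Suc v" "j' < ?count i (Suc v)"
      using entry_Suc[OF cells(2)] by blast
    then have "j < ?count i v"
      using \<open>j < j'\<close> by (auto simp: count_in_first_blocks_Suc[OF dec] split: if_splits)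
    then show ?thesis using blocks_tableau_le_iff[OF Ls cells(1), of v] v by simp
  qed
  have column: "?T (i, j) < ?T (i', j)"
    if cells: "(i, j) \<in> young_diagram lam" "(i', j) \<in> young_diagram lam" and "i < i'" for i i' j
  proof -
    obtain v where v: "v < length Ls" "?T (i', j) = Suc v" "j < ?count i' (Suc v)"
      using entry_Suc[OF cells(2)] by blast
    then have "j < ?count i v" using Ls cells(2) \<open>i < i'\<close> by (fastforce simp: ballot_blocks_iff)
    then show ?thesis using blocks_tableau_le_iff[OF Ls cells(1), of v] v by simp
  qed
  have "?T \<in> young_diagram lam \<rightarrow>\<^sub>E {1..}"
    using blocks_tableau_pos[OF Ls] by (fastforce simp: blocks_tableau_def Suc_le_eq)
  with row column show ?thesis
    by (auto simp: increasing_tableau_def max_entry_blocks_tableau[OF Ls]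
        entries_blocks_tableau[OF Ls])
qed

lemma blocks_tableau_tableau_blocks:
  assumes incr: "increasing_tableau lam T" and part: "sorted (rev lam)"
  shows "blocks_tableau lam (tableau_blocks lam T) = T"
proof (rule extensionalityI[of _ "young_diagram lam"])
  show "T \<in> extensional (young_diagram lam)"
    using incr by (auto simp: increasing_tableau_def PiE_def)
  fix x assume "x \<in> young_diagram lam"
  then obtain i j where x: "x = (i, j)" and ij: "(i, j) \<in> young_diagram lam" by (cases x) auto
  have "blocks_tableau lam (tableau_blocks lam T) (i, j) \<le> v \<longleftrightarrow> T (i, j) \<le> v" for v
  proof -
    have "blocks_tableau lam (tableau_blocks lam T) (i, j) \<le> v \<longleftrightarrow> j \<in> row_cells_le lam T i v"
      using blocks_tableau_le_iff[OF tableau_blocks_in_ballot_blocks[OF incr part] ij]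
      by (simp add: count_in_first_tableau_blocks[OF incr] mem_row_cells_le_iff[OF incr])
    with ij show ?thesis by (simp add: row_cells_le_def)
  qed
  then show "blocks_tableau lam (tableau_blocks lam T) x = T x"
    unfolding x by (meson le_antisym order_refl)
qed (simp add: blocks_tableau_def)

lemma tableau_blocks_blocks_tableau:
  assumes Ls: "Ls \<in> ballot_blocks lam"
  shows "tableau_blocks lam (blocks_tableau lam Ls) = Ls"
proof (rule nth_equalityI)
  show len: "length (tableau_blocks lam (blocks_tableau lam Ls)) = length Ls"
    by (simp add: max_entry_blocks_tableau[OF Ls])
  fix v assume "v < length (tableau_blocks lam (blocks_tableau lam Ls))"
  then have v: "v < length Ls" by (simp only: len)
  then have "sorted_wrt (<) (rev (Ls ! v))"
    using decreasing_blocks_if_ballot_blocks[OF Ls]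
    by (simp add: decreasing_blocks_def sorted_wrt_rev)
  then have "sorted_list_of_set (set (rev (Ls ! v))) = rev (Ls ! v)"
    by (simp add: sorted_list_of_set.idem_if_sorted_distinct strict_sorted_iff del: set_rev)
  with v show "tableau_blocks lam (blocks_tableau lam Ls) ! v = Ls ! v"
    by (simp add: tableau_blocks_def max_entry_blocks_tableau[OF Ls]
        rows_with_entry_blocks_tableau[OF Ls])
qed

lemma bij_betw_tableau_blocks:
  assumes "sorted (rev lam)"
  shows "bij_betw (tableau_blocks lam) {T. increasing_tableau lam T} (ballot_blocks lam)"
  using assms
  by (intro bij_betw_byWitness[where f' = "blocks_tableau lam"])
     (auto simp: blocks_tableau_tableau_blocks tableau_blocks_blocks_tableau
       tableau_blocks_in_ballot_blocks increasing_blocks_tableau)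

theorem card_Inc_eq_sum_ballot_words:
  assumes "sorted (rev lam)"
  shows "card (Inc k lam) = (\<Sum>P\<in>ballot_words lam. card (ascents P) choose k)"
proof -
  have "bij_betw (tableau_blocks lam)
      {T \<in> {T. increasing_tableau lam T}. max_entry lam T + k = sum_list lam}
      {Ls \<in> ballot_blocks lam. length Ls + k = sum_list lam}"
    using assms by (intro bij_betw_Collect bij_betw_tableau_blocks) simp_all
  then show ?thesis by (simp add: Inc_def bij_betw_same_card card_ballot_blocks)
qed

lemma card_ascents_ballot_word_less:
  assumes P: "P \<in> ballot_words lam" and ij: "(i, j) \<in> young_diagram lam"
  shows "card (ascents P) + i + j < sum_list lam"
proof -
  have part: "sorted (rev lam)" using P by (force simp: ballot_words_def)
  have "card (factorizations_with_uncut (card (ascents P)) P) = 1"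
    by (simp add: card_factorizations_with_uncut)
  then have "factorizations_with_uncut (card (ascents P)) P \<noteq> {}"
    by (metis card.empty zero_neq_one)
  then obtain Ls where "Ls \<in> factorizations_with_uncut (card (ascents P)) P" by blast
  with P have Ls: "Ls \<in> ballot_blocks lam" "length Ls + card (ascents P) = sum_list lam"
    by (auto simp: factorizations_with_uncut_def decreasing_factorizations_def ballot_blocks_def
        length_ballot_word)
  have "i + j < blocks_tableau lam Ls (i, j)"
    by (rule increasing_tableau_gt_index_sum[OF increasing_blocks_tableau[OF Ls(1)] part ij])
  also have "\<dots> \<le> length Ls" by (rule blocks_tableau_le_length[OF Ls(1) ij])
  finally show ?thesis using Ls(2) by simp
qed

lemma card_ascents_lattice_path_le:
  assumes "P \<in> lattice_paths m n" "m \<ge> 1" "n \<ge> 1"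
  shows "card (ascents P) \<le> (m - 1) * (n - 1)"
proof -
  obtain m' n' where mn: "m = Suc m'" "n = Suc n'" using assms(2,3) by (cases m; cases n) auto
  have "card (ascents P) + m' + n' < sum_list (replicate m n)"
    using assms(1) by (intro card_ascents_ballot_word_less)
      (auto simp: lattice_paths_eq_ballot_words mn simp del: replicate_Suc)
  then show ?thesis by (simp add: mn sum_list_replicate)
qed

theorem theorem2p4:
  fixes m n k :: nat
  assumes "m \<ge> 2" and "n \<ge> 1"
  shows "card (Inc_rect k m n) =
    (\<Sum>l = k..(m - 1) * (n - 1). (l choose k) * narayana m n l)"
proof -
  let ?b = "(m - 1) * (n - 1)"
  have "card (Inc_rect k m n) = (\<Sum>P\<in>lattice_paths m n. card (ascents P) choose k)"
    by (simp add: Inc_rect_def card_Inc_eq_sum_ballot_words lattice_paths_eq_ballot_words)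
  also have "\<dots> = (\<Sum>l\<le>?b. \<Sum>P | P \<in> lattice_paths m n \<and> card (ascents P) = l.
      card (ascents P) choose k)"
    using assms card_ascents_lattice_path_le[of _ m n]
    by (intro sum.group[symmetric])
       (auto simp: lattice_paths_eq_ballot_words finite_ballot_words)
  also have "\<dots> = (\<Sum>l\<le>?b. (l choose k) * narayana m n l)"
    by (simp add: narayana_def mult.commute)
  also have "\<dots> = (\<Sum>l = k..?b. (l choose k) * narayana m n l)"
    by (intro sum.mono_neutral_right) auto
  finally show ?thesis .
qed

end
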